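(* Let $\mathbb{F}$ be a finite field. No excluded minor for the class of $\mathbb{F}$-representable matroids has a restriction isomorphic to $\mathrm{PG}(2,\mathbb{F})$.
   Context: All matroids are finite. $\mathrm{PG}(2,\mathbb{F})$ is the rank-$3$ projective geometry over $\mathbb{F}$. An excluded minor for the (minor-closed) class of $\mathbb{F}$-representable matroids is a matroid that is not $\mathbb{F}$-representable but all of whose proper minors are $\mathbb{F}$-representable. *)

theory Defs
  imports "HOL-Analysis.Analysis" "HOL-Library.Function_Algebras"
begin

section \<open>Finite matroids\<close>

definition is_matroid :: "'a set \<Rightarrow> ('a set \<Rightarrow> bool) \<Rightarrow> bool" where
  "is_matroid E \<I> \<longleftrightarrow>
     finite E \<and> (\<forall>X. \<I> X \<longrightarrow> X \<subseteq> E) \<and> \<I> {} \<and>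
     (\<forall>X Y. \<I> Y \<and> X \<subseteq> Y \<longrightarrow> \<I> X) \<and>
     (\<forall>X Y. \<I> X \<and> \<I> Y \<and> card X < card Y \<longrightarrow> (\<exists>y\<in>Y - X. \<I> (insert y X)))"

lemma is_matroidI:
  assumes "finite E" "\<And>X. \<I> X \<Longrightarrow> X \<subseteq> E" "\<I> {}"
    and "\<And>X Y. \<I> Y \<Longrightarrow> X \<subseteq> Y \<Longrightarrow> \<I> X"
    and "\<And>X Y. \<I> X \<Longrightarrow> \<I> Y \<Longrightarrow> card X < card Y \<Longrightarrow> \<exists>y\<in>Y - X. \<I> (insert y X)"
  shows "is_matroid E \<I>"
  unfolding is_matroid_def using assms by (intro conjI allI impI) blast+

typedef 'a matroid = "{(E :: 'a set, \<I>). is_matroid E \<I>}"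
  by (rule exI[of _ "({}, \<lambda>X. X = {})"]) (auto intro: is_matroidI)

setup_lifting type_definition_matroid

lift_definition ground :: "'a matroid \<Rightarrow> 'a set" is fst .

lift_definition indep :: "'a matroid \<Rightarrow> 'a set \<Rightarrow> bool" is snd .

lemma is_matroid_indep: "is_matroid (ground M) (indep M)"
  by transfer (simp add: case_prod_beta)

lemma finite_ground [simp]: "finite (ground M)"
  and indep_subset_ground: "indep M X \<Longrightarrow> X \<subseteq> ground M"
  and indep_empty [simp]: "indep M {}"
  and indep_mono: "indep M Y \<Longrightarrow> X \<subseteq> Y \<Longrightarrow> indep M X"
  and indep_augment:
    "indep M X \<Longrightarrow> indep M Y \<Longrightarrow> card X < card Y \<Longrightarrow> \<exists>y\<in>Y - X. indep M (insert y X)"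
  using is_matroid_indep[of M] unfolding is_matroid_def by blast+

lemma indep_finite: "indep M X \<Longrightarrow> finite X"
  using finite_subset[OF indep_subset_ground finite_ground] .

lemma matroid_eqI: "ground M = ground N \<Longrightarrow> indep M = indep N \<Longrightarrow> M = N"
  by transfer (auto simp: prod_eq_iff)

definition basis_of :: "'a matroid \<Rightarrow> 'a set \<Rightarrow> 'a set \<Rightarrow> bool" where
  "basis_of M T B \<longleftrightarrow> B \<subseteq> T \<and> indep M B \<and> (\<forall>x\<in>T - B. \<not> indep M (insert x B))"

section \<open>Minors and isomorphism\<close>

lemma is_matroid_delete: "is_matroid (ground M - D) (\<lambda>X. X \<subseteq> ground M - D \<and> indep M X)"
proof (rule is_matroidI)
  fix X Y
  assume "X \<subseteq> ground M - D \<and> indep M X" "Y \<subseteq> ground M - D \<and> indep M Y" "card X < card Y"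
  then show "\<exists>y\<in>Y - X. insert y X \<subseteq> ground M - D \<and> indep M (insert y X)"
    using indep_augment[of M X Y] by auto
qed (auto intro: indep_mono)

lift_definition delete :: "'a matroid \<Rightarrow> 'a set \<Rightarrow> 'a matroid" is
  "\<lambda>M D. (ground M - D, \<lambda>X. X \<subseteq> ground M - D \<and> indep M X)"
  by (simp add: is_matroid_delete)

definition restriction :: "'a matroid \<Rightarrow> 'a set \<Rightarrow> 'a matroid" where
  "restriction M X = delete M (ground M - X)"

lemma basis_of_card_eq:
  assumes "basis_of M T B" "basis_of M T B'"
  shows "card B = card B'"
proof (rule ccontr)
  have *: False if b: "basis_of M T B" "basis_of M T B'" "card B < card B'" for B B'
  proof -
    obtain y where "y \<in> B' - B" "indep M (insert y B)"
      using indep_augment[of M B B'] b unfolding basis_of_def by blast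
    then show False
      using b unfolding basis_of_def by blast
  qed
  assume "card B \<noteq> card B'"
  then show False
    using *[of B B'] *[of B' B] assms by linarith
qed

lemma contract_augment:
  assumes X: "X \<subseteq> ground M - T" "basis_of M T B" "indep M (X \<union> B)"
    and Y: "Y \<subseteq> ground M - T" "basis_of M T B'" "indep M (Y \<union> B')"
    and less: "card X < card Y"
  shows "\<exists>y\<in>Y - X. basis_of M T B \<and> indep M (insert y X \<union> B)"
proof -
  have sub: "B \<subseteq> T" "B' \<subseteq> T"
    using X(2) Y(2) by (auto simp: basis_of_def)
  have fin: "finite X" "finite B" "finite Y" "finite B'"
    using indep_finite[OF X(3)] indep_finite[OF Y(3)] by auto
  have "card (X \<union> B) = card X + card B" "card (Y \<union> B') = card Y + card B'"
    using sub X(1) Y(1) fin by (auto intro!: card_Un_disjoint)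
  then have "card (X \<union> B) < card (Y \<union> B')"
    using less basis_of_card_eq[OF X(2) Y(2)] by simp
  then obtain y where y: "y \<in> (Y \<union> B') - (X \<union> B)" "indep M (insert y (X \<union> B))"
    using indep_augment[OF X(3) Y(3)] by blast
  have "y \<notin> B'"
  proof
    assume "y \<in> B'"
    then have "y \<in> T - B" using sub y by blast
    moreover have "indep M (insert y B)" using indep_mono[OF y(2)] by blast
    ultimately show False using X(2) by (auto simp: basis_of_def)
  qed
  then show ?thesis
    using y X(2) by auto
qed

lemma basis_of_exists: "\<exists>B. basis_of M T B"
proof -
  let ?C = "{B. B \<subseteq> T \<and> indep M B}"
  have "finite ?C"
    by (rule finite_subset[of _ "Pow (ground M)"]) (auto dest: indep_subset_ground)
  moreover have "{} \<in> ?C" by simp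
  ultimately obtain B where B: "B \<in> ?C" "\<And>A. A \<in> ?C \<Longrightarrow> B \<subseteq> A \<Longrightarrow> A = B"
    using finite_has_maximal2[of ?C "{}"] by (metis (lifting))
  then have "basis_of M T B"
    unfolding basis_of_def by blast
  then show ?thesis ..
qed

lemma is_matroid_contract:
  "is_matroid (ground M - T)
     (\<lambda>X. X \<subseteq> ground M - T \<and> (\<exists>B. basis_of M T B \<and> indep M (X \<union> B)))"
proof (rule is_matroidI)
  show "{} \<subseteq> ground M - T \<and> (\<exists>B. basis_of M T B \<and> indep M ({} \<union> B))"
    using basis_of_exists[of M T] by (auto simp: basis_of_def)
next
  fix X Y
  assume Y: "Y \<subseteq> ground M - T \<and> (\<exists>B. basis_of M T B \<and> indep M (Y \<union> B))" and "X \<subseteq> Y"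
  then obtain B where "basis_of M T B" "indep M (Y \<union> B)" by blast
  moreover have "indep M (X \<union> B)"
    by (rule indep_mono[OF \<open>indep M (Y \<union> B)\<close>]) (use \<open>X \<subseteq> Y\<close> in blast)
  ultimately show "X \<subseteq> ground M - T \<and> (\<exists>B. basis_of M T B \<and> indep M (X \<union> B))"
    using Y \<open>X \<subseteq> Y\<close> by blast
next
  fix X Y
  assume X: "X \<subseteq> ground M - T \<and> (\<exists>B. basis_of M T B \<and> indep M (X \<union> B))"
    and Y: "Y \<subseteq> ground M - T \<and> (\<exists>B. basis_of M T B \<and> indep M (Y \<union> B))"
    and less: "card X < card Y"
  obtain B B' where B: "basis_of M T B" "indep M (X \<union> B)"
    and B': "basis_of M T B'" "indep M (Y \<union> B')"
    using X Y by blast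
  obtain y where y: "y \<in> Y - X" "indep M (insert y X \<union> B)"
    using contract_augment[OF _ B _ B' less] X Y by blast
  have "insert y X \<subseteq> ground M - T" using X Y y(1) by blast
  then show "\<exists>y\<in>Y - X. insert y X \<subseteq> ground M - T \<and>
      (\<exists>B. basis_of M T B \<and> indep M (insert y X \<union> B))"
    using y B(1) by blast
qed auto

lift_definition contract :: "'a matroid \<Rightarrow> 'a set \<Rightarrow> 'a matroid" is
  "\<lambda>M T. (ground M - T,
          \<lambda>X. X \<subseteq> ground M - T \<and> (\<exists>B. basis_of M T B \<and> indep M (X \<union> B)))"
  by (simp add: is_matroid_contract)

definition minor :: "'a matroid \<Rightarrow> 'a matroid \<Rightarrow> bool" where
  "minor N M \<longleftrightarrow>
     (\<exists>C D. C \<subseteq> ground M \<and> D \<subseteq> ground M \<and> C \<inter> D = {} \<and> N = delete (contract M C) D)"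

definition proper_minor :: "'a matroid \<Rightarrow> 'a matroid \<Rightarrow> bool" where
  "proper_minor N M \<longleftrightarrow> minor N M \<and> N \<noteq> M"

definition isomorphic :: "'a matroid \<Rightarrow> 'b matroid \<Rightarrow> bool" where
  "isomorphic M N \<longleftrightarrow>
     (\<exists>f. bij_betw f (ground M) (ground N) \<and>
          (\<forall>X \<subseteq> ground M. indep M X \<longleftrightarrow> indep N (f ` X)))"

section \<open>Representability over a field\<close>

interpretation seq: vector_space "\<lambda>(c :: 'f :: field) (v :: nat \<Rightarrow> 'f) i. c * v i"
  by unfold_locales (auto simp: fun_eq_iff algebra_simps)

text \<open>
  The space of column vectors of length \<open>n\<close> over \<open>'f\<close> is the subspace
  of sequences vanishing from index \<open>n\<close> on. The set \<open>X\<close> is independent iff the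
  family of its vectors is linearly independent; injectivity on \<open>X\<close> makes distinct elements
  with equal vectors dependent.
\<close>

definition representable :: "'f :: field itself \<Rightarrow> 'a matroid \<Rightarrow> bool" where
  "representable _ M \<longleftrightarrow>
     (\<exists>n. \<exists>\<phi> :: 'a \<Rightarrow> nat \<Rightarrow> 'f.
        (\<forall>e \<in> ground M. \<forall>i \<ge> n. \<phi> e i = 0) \<and>
        (\<forall>X \<subseteq> ground M. indep M X \<longleftrightarrow> inj_on \<phi> X \<and> seq.independent (\<phi> ` X)))"

definition excluded_minor :: "'f :: field itself \<Rightarrow> 'a matroid \<Rightarrow> bool" where
  "excluded_minor F M \<longleftrightarrow>
     \<not> representable F M \<and> (\<forall>N. proper_minor N M \<longrightarrow> representable F N)"

section \<open>Projective geometries\<close>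

definition proj_points :: "('f :: field ^ 'n) set set" where
  "proj_points = {vec.span {v} | v. v \<noteq> 0}"

lemma dim_Union_insert:
  fixes X :: "('f :: field ^ 'n) set set"
  assumes "p \<in> proj_points"
  shows "vec.dim (\<Union>(insert p X)) =
         (if p \<subseteq> vec.span (\<Union>X) then vec.dim (\<Union>X) else vec.dim (\<Union>X) + 1)"
proof -
  obtain v where v: "p = vec.span {v}"
    using assms by (auto simp: proj_points_def)
  have "vec.span (\<Union>(insert p X)) = vec.span (insert v (\<Union>X))"
  proof (rule antisym; rule vec.span_minimal)
    show "\<Union>(insert p X) \<subseteq> vec.span (insert v (\<Union>X))"
      unfolding v using vec.span_mono[of "{v}" "insert v (\<Union>X)"] vec.span_superset[of "insert v (\<Union>X)"]
      by auto
    have "v \<in> p" unfolding v by (rule vec.span_base) simp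
    then show "insert v (\<Union>X) \<subseteq> vec.span (\<Union>(insert p X))"
      using vec.span_superset[of "\<Union>(insert p X)"] by auto
  qed auto
  then have "vec.dim (\<Union>(insert p X)) = vec.dim (insert v (\<Union>X))"
    by (rule vec.span_eq_dim)
  moreover have "v \<in> vec.span (\<Union>X) \<longleftrightarrow> p \<subseteq> vec.span (\<Union>X)"
    unfolding v using vec.span_base[of v "{v}"]
      vec.span_minimal[of "{v}" "vec.span (\<Union>X)"] by auto
  ultimately show ?thesis
    by (simp add: vec.dim_insert)
qed

lemma dim_Union_Un_le:
  fixes X :: "('f :: field ^ 'n) set set"
  assumes "finite Z" "Z \<subseteq> proj_points"
  shows "vec.dim (\<Union>(Z \<union> X)) \<le> vec.dim (\<Union>X) + card Z"
  using assms
proof (induction Z rule: finite_induct)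
  case (insert p Z)
  then show ?case
    using dim_Union_insert[of p "Z \<union> X"] by (auto split: if_splits)
qed simp

lemma is_matroid_PG:
  "is_matroid (proj_points :: ('f :: {field, finite} ^ 'n) set set)
     (\<lambda>X. X \<subseteq> proj_points \<and> vec.dim (\<Union>X) = card X)"
proof (rule is_matroidI)
  fix X Y :: "('f ^ 'n) set set"
  assume Y: "Y \<subseteq> proj_points \<and> vec.dim (\<Union>Y) = card Y" and "X \<subseteq> Y"
  then have X: "X \<subseteq> proj_points" by blast
  have "Y = (Y - X) \<union> X" using \<open>X \<subseteq> Y\<close> by blast
  moreover have "vec.dim (\<Union>((Y - X) \<union> X)) \<le> vec.dim (\<Union>X) + card (Y - X)"
    by (rule dim_Union_Un_le) (use Y in auto)
  ultimately have "card Y \<le> vec.dim (\<Union>X) + card (Y - X)"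
    using Y by simp
  moreover have "card Y = card X + card (Y - X)"
    using \<open>X \<subseteq> Y\<close> by (simp add: card_Diff_subset card_mono)
  moreover have "vec.dim (\<Union>X) \<le> card X"
    using dim_Union_Un_le[of X "{}"] X by simp
  ultimately show "X \<subseteq> proj_points \<and> vec.dim (\<Union>X) = card X"
    using X by simp
next
  fix X Y :: "('f ^ 'n) set set"
  assume X: "X \<subseteq> proj_points \<and> vec.dim (\<Union>X) = card X"
    and Y: "Y \<subseteq> proj_points \<and> vec.dim (\<Union>Y) = card Y" and less: "card X < card Y"
  have "\<not> \<Union>Y \<subseteq> vec.span (\<Union>X)"
    using vec.dim_mono[of "\<Union>Y" "\<Union>X"] X Y less by linarith
  then obtain p where p: "p \<in> Y" "\<not> p \<subseteq> vec.span (\<Union>X)" by blast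
  then have "p \<notin> X" using vec.span_superset[of "\<Union>X"] by blast
  moreover have "p \<in> proj_points" using p Y by blast
  ultimately have "vec.dim (\<Union>(insert p X)) = card (insert p X)"
    unfolding dim_Union_insert[OF \<open>p \<in> proj_points\<close>] using p X by simp
  then show "\<exists>y\<in>Y - X. insert y X \<subseteq> proj_points \<and> vec.dim (\<Union>(insert y X)) = card (insert y X)"
    using p X \<open>p \<notin> X\<close> \<open>p \<in> proj_points\<close> by (intro bexI[of _ p]) simp_all
qed auto

text \<open>
  The points of \<open>PG(k - 1, \<F>)\<close> are the one-dimensional subspaces of \<open>\<F>\<^sup>k\<close>,
  where \<open>k = CARD('n)\<close>; the rank of a set of points is the dimension of its span,
  and a set is independent iff its rank equals its cardinality.
\<close>

lift_definition PG :: "(('f :: {field, finite}) ^ 'n) set matroid" is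
  "(proj_points, \<lambda>X. X \<subseteq> proj_points \<and> vec.dim (\<Union>X) = card X)"
  by (simp only: mem_Collect_eq case_prod_conv is_matroid_PG)

end

theory Submission
  imports Defs
begin

text \<open>
  Let \<open>P\<close> be a \<open>PG(2,q)\<close>-restriction of \<open>M\<close>, where all proper minors of \<open>M\<close> are representable over
  the field with \<open>q\<close> elements. A representation of \<open>M\<close> is obtained by repairing a representation
  \<open>\<phi>\<close> of \<open>M\<close> with a single point \<open>p\<close> of \<open>P\<close> deleted.

  The plane has as many points as a three-dimensional space has directions. Hence the
  vectors of \<open>P - {p}\<close> miss exactly one direction of the space that they span; let \<open>v\<close> be a vector
  in this direction. Two lines through \<open>p\<close> must still intersect in the representation, and the
  missing direction is the only place left for this, so \<open>v\<close> completes every line through \<open>p\<close>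
  (\<open>v_on_two_lines\<close>). The claim is that \<open>\<phi>\<close> extended by \<open>p \<mapsto> v\<close> represents \<open>M\<close>, that is, an
  independent set \<open>I\<close> without \<open>p\<close> spans \<open>p\<close> iff \<open>v\<close> is in the span of \<open>\<phi> ` I\<close>
  (\<open>spans_missing_iff\<close>).

  If \<open>I\<close> spans another point \<open>a\<close> of \<open>P\<close>, this is seen on the line \<open>ap\<close>. Otherwise
  \<open>p\<close> is the only point of the plane that \<open>I\<close> can span, and \<open>v\<close> the only direction of the plane's
  space that can lie in the span of \<open>\<phi> ` I\<close>. Both happen iff \<open>I\<close> is not skew to \<open>P\<close>, provided that
  \<open>P\<close> is modular in \<open>M\<close>, in the sense that every independent set that is not skew to \<open>P\<close> spans a
  point of \<open>P\<close> (\<open>meets_plane\<close>).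

  Modularity holds in every representable matroid, because the plane fills its
  three-dimensional span. For \<open>M\<close> itself it is inherited from \<open>M / e\<close> for any \<open>e \<in> I\<close> outside the closure
  of \<open>P\<close> (\<open>contract_meets_plane\<close>). If \<open>I\<close> lies within the closure of \<open>P\<close>, it suffices that every nonloop
  there is parallel to a point of \<open>P\<close> (\<open>parallel_to_plane\<close>), which is read off from \<open>\<phi>\<close>.
\<close>

section \<open>Linear algebra over a finite field\<close>

lemma (in vector_space) independent_Un_span_Int:
  assumes "finite A" "independent (A \<union> B)" "A \<inter> B = {}" "v \<in> span A" "v \<in> span B"
  shows "v = 0"
  using assms
proof (induction A rule: finite_induct)
  case (insert a A)
  obtain k where k: "v - scale k a \<in> span A"
    using insert.prems(3) by (auto simp: span_breakdown_eq)
  show ?case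
  proof (cases "k = 0")
    case True
    then show ?thesis
      using insert k independent_mono[of "insert a A \<union> B" "A \<union> B"] by auto
  next
    case False
    have "v - (v - scale k a) \<in> span (A \<union> B)"
      by (rule span_diff)
        (use insert.prems(4) k span_mono[of A "A \<union> B"] span_mono[of B "A \<union> B"] in blast)+
    then have "scale k a \<in> span (A \<union> B)"
      by (simp only: diff_diff_eq2 add_diff_cancel_left')
    then have "scale (inverse k) (scale k a) \<in> span (A \<union> B)"
      by (rule span_scale)
    moreover have "scale (inverse k) (scale k a) = a"
      using False by simp
    ultimately have "a \<in> span (A \<union> B)"
      by (simp only:)
    moreover have "a \<notin> A \<union> B"
      using insert.hyps(2) insert.prems(2) by auto
    ultimately show ?thesis
      using insert.prems(1) by (simp add: independent_insert)
  qed
qed simp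

lemma (in vector_space) dependent_Un_span_Int:
  assumes "finite B" "independent A" "independent B" "A \<inter> B \<noteq> {} \<or> dependent (A \<union> B)"
  shows "\<exists>w. w \<noteq> 0 \<and> w \<in> span A \<and> w \<in> span B"
  using assms
proof (induction B rule: finite_induct)
  case (insert b B)
  have B: "independent B" "b \<notin> span B"
    using insert.prems(2) insert.hyps(2) by (auto simp: independent_insert)
  show ?case
  proof (cases "A \<inter> B \<noteq> {} \<or> dependent (A \<union> B)")
    case True
    then show ?thesis
      using insert.IH insert.prems(1) B(1) span_mono[of B "insert b B"] by blast
  next
    case False
    have "b \<in> span (A \<union> B)"
    proof (cases "b \<in> A")
      case False
      then have "dependent (insert b (A \<union> B))"
        using insert.prems(3) \<open>\<not> (A \<inter> B \<noteq> {} \<or> dependent (A \<union> B))\<close> by auto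
      then show ?thesis
        using \<open>\<not> (A \<inter> B \<noteq> {} \<or> dependent (A \<union> B))\<close> independent_insertI by blast
    qed (simp add: span_base)
    then obtain s t where st: "b = s + t" "s \<in> span A" "t \<in> span B"
      unfolding span_Un by blast
    have "s = b - t"
      using st(1) by simp
    also have "\<dots> \<in> span (insert b B)"
      by (rule span_diff) (use st(3) span_mono[of B "insert b B"] span_base in blast)+
    finally have "s \<in> span (insert b B)" .
    moreover have "s \<noteq> 0"
      using st(1,3) B(2) by auto
    ultimately show ?thesis
      using st(2) by blast
  qed
qed auto

text \<open>
  Inductively, \<open>(c, s) \<mapsto> c b + s\<close> is a bijection onto the larger span.
\<close>
lemma (in vector_space) card_span_independent:
  assumes "finite (UNIV :: 'a set)" "finite B" "independent B"
  shows "finite (span B) \<and> card (span B) = CARD('a) ^ card B"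
  using assms(2,3)
proof (induction B rule: finite_induct)
  case (insert b B)
  have B: "independent B" "b \<notin> span B"
    using insert.prems insert.hyps(2) by (auto simp: independent_insert)
  have "inj_on (\<lambda>(c, s). scale c b + s) (UNIV \<times> span B)"
  proof (rule inj_onI, clarify)
    fix c s d t
    assume st: "s \<in> span B" "t \<in> span B" "scale c b + s = scale d b + t"
    then have "scale (c - d) b = t - s"
      by (simp add: scale_left_diff_distrib algebra_simps)
    then have "scale (c - d) b \<in> span B"
      using st by (simp add: span_diff)
    then have "scale (inverse (c - d)) (scale (c - d) b) \<in> span B"
      by (rule span_scale)
    moreover have "scale (inverse (c - d)) (scale (c - d) b) = b" if "c \<noteq> d"
      using that by simp
    ultimately have "c = d"
      using B(2) by metis
    then show "c = d \<and> s = t"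
      using st(3) by simp
  qed
  moreover have "(\<lambda>(c, s). scale c b + s) ` (UNIV \<times> span B) = span (insert b B)"
  proof (intro equalityI subsetI)
    fix x assume "x \<in> (\<lambda>(c, s). scale c b + s) ` (UNIV \<times> span B)"
    then obtain c s where "x = scale c b + s" "s \<in> span B"
      by auto
    then have "x - scale c b \<in> span B"
      by simp
    then show "x \<in> span (insert b B)"
      by (auto simp: span_breakdown_eq)
  next
    fix x assume "x \<in> span (insert b B)"
    then obtain k where "x - scale k b \<in> span B"
      by (auto simp: span_breakdown_eq)
    then show "x \<in> (\<lambda>(c, s). scale c b + s) ` (UNIV \<times> span B)"
      by (intro image_eqI[of _ _ "(k, x - scale k b)"]) auto
  qed
  ultimately have "bij_betw (\<lambda>(c, s). scale c b + s) (UNIV \<times> span B) (span (insert b B))"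
    by (simp add: bij_betw_def)
  then have "card (span (insert b B)) = CARD('a) * card (span B)"
      "finite (span (insert b B)) \<longleftrightarrow> finite ((UNIV :: 'a set) \<times> span B)"
    by (simp_all add: bij_betw_same_card[symmetric] card_cartesian_product bij_betw_finite)
  then show ?case
    using insert.IH[OF B(1)] insert.hyps assms(1) by simp
qed simp

lemma (in vector_space) card_multiples:
  assumes "finite (UNIV :: 'a set)"
    and "\<And>x. x \<in> P \<Longrightarrow> \<phi> x \<noteq> 0"
    and "\<And>x y c. x \<in> P \<Longrightarrow> y \<in> P \<Longrightarrow> x \<noteq> y \<Longrightarrow> \<phi> x \<noteq> scale c (\<phi> y)"
  shows "card {scale c (\<phi> x) | c x. c \<noteq> 0 \<and> x \<in> P} = (CARD('a) - 1) * card P"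
proof -
  have "inj_on (\<lambda>(c, x). scale c (\<phi> x)) ((UNIV - {0}) \<times> P)"
  proof (rule inj_onI)
    fix u w
    assume uw: "u \<in> (UNIV - {0}) \<times> P" "w \<in> (UNIV - {0}) \<times> P"
      "(\<lambda>(c, x). scale c (\<phi> x)) u = (\<lambda>(c, x). scale c (\<phi> x)) w"
    obtain c x d y where u: "u = (c, x)" and w: "w = (d, y)"
      by (cases u, cases w)
    have *: "c \<noteq> 0" "d \<noteq> 0" "x \<in> P" "y \<in> P" "scale c (\<phi> x) = scale d (\<phi> y)"
      using uw unfolding u w by auto
    then have "\<phi> x = scale (inverse c * d) (\<phi> y)"
      by (metis scale_scale left_inverse scale_one)
    then have "x = y"
      using assms(3) * by blast
    then show "u = w"
      using * assms(2) unfolding u w by simp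
  qed
  moreover have "(\<lambda>(c, x). scale c (\<phi> x)) ` ((UNIV - {0}) \<times> P) = {scale c (\<phi> x) | c x. c \<noteq> 0 \<and> x \<in> P}"
    by auto
  ultimately have "card {scale c (\<phi> x) | c x. c \<noteq> 0 \<and> x \<in> P} = card ((UNIV - {0 :: 'a}) \<times> P)"
    using card_image[of "\<lambda>(c, x). scale c (\<phi> x)" "(UNIV - {0}) \<times> P"] by simp
  then show ?thesis
    using assms(1) by (simp add: card_cartesian_product card_Diff_subset)
qed

text \<open>
  Counting: nonzero vectors of a \<open>d\<close>-dimensional space over a field with \<open>q\<close> elements fall
  into directions of \<open>q - 1\<close> vectors each, so a pairwise non-parallel family with
  \<open>(q - 1) |P| = q\<^sup>d - 1\<close> uses up every direction. This is what forces the image of a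
  projective plane under a representation to be all of the three-dimensional space it spans.
\<close>
lemma (in vector_space) parallel_classes_cover:
  assumes fin: "finite (UNIV :: 'a set)" "finite B" and B: "independent B"
    and card: "(CARD('a) - 1) * card P + 1 = CARD('a) ^ card B"
    and nz: "\<And>x. x \<in> P \<Longrightarrow> \<phi> x \<noteq> 0"
    and np: "\<And>x y c. x \<in> P \<Longrightarrow> y \<in> P \<Longrightarrow> x \<noteq> y \<Longrightarrow> \<phi> x \<noteq> scale c (\<phi> y)"
    and sub: "\<phi> ` P \<subseteq> span B"
    and w: "w \<in> span B" "w \<noteq> 0"
  shows "\<exists>x\<in>P. \<exists>c. c \<noteq> 0 \<and> w = scale c (\<phi> x)"
proof -
  let ?S = "{scale c (\<phi> x) | c x. c \<noteq> 0 \<and> x \<in> P}"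
  have span: "finite (span B)" "card (span B) = CARD('a) ^ card B"
    using card_span_independent[OF fin B] by auto
  have "?S \<subseteq> span B - {0}"
    using sub nz by (auto intro: span_scale)
  moreover have "card ?S = (CARD('a) - 1) * card P"
    by (rule card_multiples) (use fin nz np in auto)
  moreover have "card (span B - {0}) = (CARD('a) - 1) * card P"
    using span card by (simp add: card_Diff_subset span_zero)
  ultimately have "?S = span B - {0}"
    using span(1) by (intro card_subset_eq) auto
  then have "w \<in> ?S"
    using w by auto
  then show ?thesis
    by blast
qed

text \<open>
  The same count in the other direction: after one point of the plane has been removed, the
  remaining vectors can no longer meet every direction.
\<close>
lemma (in vector_space) parallel_classes_miss:
  assumes fin: "finite (UNIV :: 'a set)" "finite B" and B: "independent B"
    and card: "(CARD('a) - 1) * card P + 1 < CARD('a) ^ card B"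
    and P: "finite P"
  shows "\<exists>v\<in>span B. v \<noteq> 0 \<and> (\<forall>x\<in>P. \<forall>c. c \<noteq> 0 \<longrightarrow> v \<noteq> scale c (\<phi> x))"
proof -
  let ?S = "(\<lambda>(c, x). scale c (\<phi> x)) ` ((UNIV - {0}) \<times> P)"
  have span: "finite (span B)" "card (span B) = CARD('a) ^ card B"
    using card_span_independent[OF fin B] by auto
  have "card ?S \<le> card ((UNIV - {0 :: 'a}) \<times> P)"
    by (rule card_image_le) (use fin P in auto)
  also have "\<dots> = (CARD('a) - 1) * card P"
    using fin by (simp add: card_cartesian_product card_Diff_subset)
  finally have "card (insert 0 ?S) < card (span B)"
    using card span(2) fin P by (simp add: card_insert_if split: if_splits)
  then have "\<not> span B \<subseteq> insert 0 ?S"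
    using fin P by (meson card_mono finite_Diff finite_SigmaI finite_imageI finite_insert leD)
  then show ?thesis
    by force
qed

lemma seq_span_unscale:
  fixes u :: "nat \<Rightarrow> 'f :: field"
  assumes "w = (\<lambda>i. c * u i)" "c \<noteq> 0" "w \<in> seq.span S"
  shows "u \<in> seq.span S"
proof -
  have "(\<lambda>i. inverse c * w i) \<in> seq.span S"
    using assms(3) by (rule seq.span_scale)
  moreover have "(\<lambda>i. inverse c * w i) = u"
    using assms(1,2) by (simp add: fun_eq_iff)
  ultimately show ?thesis
    by simp
qed

section \<open>Spanning in a matroid\<close>

text \<open>
  Membership in the closure, used for independent \<open>I\<close> only; this suffices because
  independence of \<open>X\<close> can be tested by adding a last element to an independent set. For such
  \<open>I\<close> an \<open>x\<close> outside the ground set also counts as spanned.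
\<close>
definition spans :: "'a matroid \<Rightarrow> 'a set \<Rightarrow> 'a \<Rightarrow> bool" where
  "spans M I x \<longleftrightarrow> x \<in> I \<or> \<not> indep M (insert x I)"

lemma spans_base: "x \<in> I \<Longrightarrow> spans M I x"
  by (simp add: spans_def)

lemma spans_mono: "spans M I x \<Longrightarrow> I \<subseteq> J \<Longrightarrow> spans M J x"
  unfolding spans_def by (meson indep_mono insert_mono subsetD)

lemma card_indep_le_spanning:
  assumes "indep M I" "indep M K" "\<And>x. x \<in> K \<Longrightarrow> spans M I x"
  shows "card K \<le> card I"
proof (rule ccontr)
  assume "\<not> card K \<le> card I"
  then obtain y where "y \<in> K - I" "indep M (insert y I)"
    using indep_augment[OF assms(1,2)] by auto
  then show False
    using assms(3)[of y] by (auto simp: spans_def)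
qed

lemma indep_extend:
  assumes "indep M K" "indep M Z" "card K \<le> card Z"
  shows "\<exists>W. K \<subseteq> W \<and> W \<subseteq> K \<union> Z \<and> indep M W \<and> card W = card Z"
  using assms
proof (induction "card Z - card K" arbitrary: K)
  case 0
  then show ?case by (intro exI[of _ K]) auto
next
  case (Suc n)
  then obtain y where y: "y \<in> Z - K" "indep M (insert y K)"
    using indep_augment[of M K Z] by fastforce
  then have "card (insert y K) = Suc (card K)"
    using indep_finite[OF Suc.prems(1)] by simp
  then have "n = card Z - card (insert y K)" "card (insert y K) \<le> card Z"
    using Suc.hyps(2) by auto
  then obtain W where "insert y K \<subseteq> W" "W \<subseteq> insert y K \<union> Z" "indep M W" "card W = card Z"
    using Suc.hyps(1)[OF _ y(2) Suc.prems(2)] by metis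
  then show ?case
    using y by (intro exI[of _ W]) auto
qed

text \<open>
  If \<open>insert x I\<close> were independent, extending \<open>K\<close> from it to size \<open>|I| + 1\<close> could not use
  \<open>x\<close>, since \<open>K\<close> spans \<open>x\<close>; the result would be an independent set spanned by \<open>I\<close> and
  larger than \<open>I\<close>.
\<close>
lemma spans_trans:
  assumes I: "indep M I" and K: "indep M K"
    and IK: "\<And>y. y \<in> K \<Longrightarrow> spans M I y" and x: "spans M K x"
  shows "spans M I x"
proof (rule ccontr)
  assume "\<not> spans M I x"
  then have xI: "x \<notin> I" "indep M (insert x I)"
    by (auto simp: spans_def)
  have card_ins: "card (insert x I) = Suc (card I)"
    using xI(1) indep_finite[OF I] by simp
  have "card K \<le> card I"
    using card_indep_le_spanning[OF I K IK] .
  then obtain W where W: "K \<subseteq> W" "W \<subseteq> K \<union> insert x I" "indep M W" "card W = Suc (card I)"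
    using indep_extend[OF K xI(2)] card_ins by auto
  have "x \<notin> W"
  proof
    assume "x \<in> W"
    then have "indep M (insert x K)"
      using W(1) indep_mono[OF W(3)] by blast
    then have "x \<in> K"
      using x by (simp add: spans_def)
    then show False
      using IK \<open>\<not> spans M I x\<close> by blast
  qed
  then have "spans M I y" if "y \<in> W" for y
    using that W(2) IK spans_base by (metis UnE insertE subsetD)
  then have "card W \<le> card I"
    by (rule card_indep_le_spanning[OF I W(3)])
  then show False
    using W(4) by simp
qed

lemma spans_eqI:
  assumes I: "indep M I" and K: "indep M K" "card K = card I"
    and IK: "\<And>y. y \<in> K \<Longrightarrow> spans M I y" and x: "spans M I x"
  shows "spans M K x"
proof (rule ccontr)
  assume "\<not> spans M K x"
  then have "indep M (insert x K)" "x \<notin> K"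
    by (auto simp: spans_def)
  moreover have "spans M I y" if "y \<in> insert x K" for y
    using that IK x by blast
  ultimately have "card (insert x K) \<le> card I"
    using card_indep_le_spanning[OF I] by blast
  then show False
    using K \<open>x \<notin> K\<close> indep_finite[OF K(1)] by simp
qed

text \<open>
  Exchange \<open>p\<close> for some \<open>i \<in> I\<close>: then \<open>I - {i}\<close> and \<open>p\<close> together span \<open>i\<close>, and \<open>J\<close>
  spans \<open>p\<close>, so \<open>i\<close> is redundant in \<open>I \<union> J\<close>.
\<close>
lemma common_span_not_skew:
  assumes I: "indep M I" and J: "indep M J" and disj: "I \<inter> J = {}"
    and p: "indep M {p}" "spans M I p" "spans M J p"
  shows "\<not> indep M (I \<union> J)"
proof
  assume IJ: "indep M (I \<union> J)"
  have "I \<noteq> {}"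
    using p by (auto simp: spans_def)
  then have "card {p} \<le> card I"
    using indep_finite[OF I] by (simp add: Suc_leI card_gt_0_iff)
  then obtain W where W: "{p} \<subseteq> W" "W \<subseteq> {p} \<union> I" "indep M W" "card W = card I"
    using indep_extend[OF p(1) I] by blast
  have "p \<notin> I"
  proof
    assume "p \<in> I"
    then have "p \<notin> J" "insert p J \<subseteq> I \<union> J"
      using disj by auto
    then show False
      using p(3) indep_mono[OF IJ] by (auto simp: spans_def)
  qed
  then obtain i where i: "i \<in> I" "i \<notin> W"
    using W indep_finite[OF W(3)] by (metis card_subset_eq insert_subset subsetI)
  let ?I = "I - {i}"
  have J': "indep M (?I \<union> J)"
    by (rule indep_mono[OF IJ]) auto
  have "spans M W i"
    by (rule spans_eqI[OF I W(3,4)]) (use W(2) p(2) i spans_base[of _ I M] in auto)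
  moreover have "spans M (?I \<union> J) y" if "y \<in> W" for y
  proof (cases "y = p")
    case True
    then show ?thesis
      using p(3) by (auto intro: spans_mono)
  next
    case False
    then show ?thesis
      using that W(2) i by (intro spans_base) auto
  qed
  ultimately have "spans M (?I \<union> J) i"
    using spans_trans[OF J' W(3)] by blast
  moreover have "insert i (?I \<union> J) = I \<union> J"
    using i by auto
  ultimately show False
    using IJ disj i by (auto simp: spans_def)
qed

section \<open>Representations\<close>

text \<open>
  The bound on the number of coordinates is left out, since arguments about a representation
  take place inside the span of its vectors.
\<close>
definition represents :: "('a \<Rightarrow> nat \<Rightarrow> 'f :: field) \<Rightarrow> 'a matroid \<Rightarrow> bool" where
  "represents \<phi> M \<longleftrightarrow>
     (\<forall>X \<subseteq> ground M. indep M X \<longleftrightarrow> inj_on \<phi> X \<and> seq.independent (\<phi> ` X))"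

lemma represents_iff:
  assumes "represents \<phi> M" "X \<subseteq> ground M"
  shows "indep M X \<longleftrightarrow> inj_on \<phi> X \<and> seq.independent (\<phi> ` X)"
  using assms unfolding represents_def by blast

lemma represents_indep:
  assumes "represents \<phi> M" "indep M X"
  shows "inj_on \<phi> X" "seq.independent (\<phi> ` X)"
  using represents_iff[OF assms(1) indep_subset_ground[OF assms(2)]] assms(2) by auto

lemma represents_spans_iff:
  assumes \<phi>: "represents \<phi> M" and I: "indep M I" and x: "x \<in> ground M"
  shows "spans M I x \<longleftrightarrow> \<phi> x \<in> seq.span (\<phi> ` I)"
proof (cases "x \<in> I")
  case True
  then show ?thesis
    by (simp add: spans_def seq.span_base)
next
  case False
  have "indep M (insert x I) \<longleftrightarrow> inj_on \<phi> (insert x I) \<and> seq.independent (\<phi> ` insert x I)"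
    by (rule represents_iff[OF \<phi>]) (use x indep_subset_ground[OF I] in auto)
  moreover have "\<dots> \<longleftrightarrow> \<phi> x \<notin> seq.span (\<phi> ` I)"
    using represents_indep[OF \<phi> I] False seq.span_base[of "\<phi> x" "\<phi> ` I"]
    by (auto simp: seq.independent_insert inj_on_insert)
  ultimately show ?thesis
    using False by (simp add: spans_def)
qed

lemma represents_not_parallel:
  assumes \<phi>: "represents \<phi> M" and xy: "indep M {x, y}"
  shows "\<phi> x \<noteq> 0" and "x \<noteq> y \<Longrightarrow> \<phi> x \<noteq> (\<lambda>i. c * \<phi> y i)"
proof -
  have x: "indep M {x}" and y: "indep M {y}"
    by (rule indep_mono[OF xy]; simp)+
  show "\<phi> x \<noteq> 0"
    using represents_indep(2)[OF \<phi> x] seq.dependent_zero by fastforce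
  assume "x \<noteq> y"
  then have "\<not> spans M {y} x"
    using xy by (simp add: spans_def)
  then have "\<phi> x \<notin> seq.span {\<phi> y}"
    using represents_spans_iff[OF \<phi> y, of x] indep_subset_ground[OF x] by simp
  then show "\<phi> x \<noteq> (\<lambda>i. c * \<phi> y i)"
    by (auto simp: seq.span_singleton)
qed

text \<open>
  This turns the matroid statement that two independent sets fail to be skew into a common
  nonzero vector, which can then be located on the plane by counting.
\<close>
lemma represents_not_skew_iff:
  assumes \<phi>: "represents \<phi> M" and I: "indep M I" and J: "indep M J"
  shows "I \<inter> J \<noteq> {} \<or> \<not> indep M (I \<union> J) \<longleftrightarrow>
         (\<exists>w. w \<noteq> 0 \<and> w \<in> seq.span (\<phi> ` I) \<and> w \<in> seq.span (\<phi> ` J))"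
proof -
  note i = represents_indep[OF \<phi> I] and j = represents_indep[OF \<phi> J]
  have "indep M (I \<union> J) \<longleftrightarrow> inj_on \<phi> (I \<union> J) \<and> seq.independent (\<phi> ` (I \<union> J))"
    by (rule represents_iff[OF \<phi>]) (use indep_subset_ground[OF I] indep_subset_ground[OF J] in auto)
  then have "I \<inter> J \<noteq> {} \<or> \<not> indep M (I \<union> J) \<longleftrightarrow>
      \<phi> ` I \<inter> \<phi> ` J \<noteq> {} \<or> seq.dependent (\<phi> ` I \<union> \<phi> ` J)"
    using i(1) j(1) by (simp add: image_Un inj_on_Un) blast
  moreover have "finite (\<phi> ` I)" "finite (\<phi> ` J)"
    using indep_finite[OF I] indep_finite[OF J] by auto
  ultimately show ?thesis
    using seq.dependent_Un_span_Int[OF _ i(2) j(2)] seq.independent_Un_span_Int by metis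
qed

section \<open>Single-element deletions and contractions\<close>

lemma ground_delete [simp]: "ground (delete M D) = ground M - D"
  by (simp only: ground.rep_eq[of "delete M D"] delete.rep_eq fst_conv)

lemma indep_delete [simp]: "indep (delete M D) X \<longleftrightarrow> X \<subseteq> ground M - D \<and> indep M X"
  by (simp only: indep.rep_eq[of "delete M D"] delete.rep_eq snd_conv)

lemma ground_contract [simp]: "ground (contract M T) = ground M - T"
  by (simp only: ground.rep_eq[of "contract M T"] contract.rep_eq fst_conv)

lemma indep_contract:
  "indep (contract M T) X \<longleftrightarrow> X \<subseteq> ground M - T \<and> (\<exists>B. basis_of M T B \<and> indep M (X \<union> B))"
  by (simp only: indep.rep_eq[of "contract M T"] contract.rep_eq snd_conv)

lemma contract_empty: "contract M {} = M"
proof (rule matroid_eqI)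
  have "basis_of M {} B \<longleftrightarrow> B = {}" for B
    by (auto simp: basis_of_def)
  then show "indep (contract M {}) = indep M"
    by (auto simp: fun_eq_iff indep_contract dest: indep_subset_ground)
qed simp

text \<open>
  A nonloop is the only basis of its own singleton, which removes the choice of basis from the
  definition of contraction.
\<close>
lemma indep_contract_nonloop:
  assumes "indep M {e}"
  shows "indep (contract M {e}) X \<longleftrightarrow> X \<subseteq> ground M - {e} \<and> indep M (insert e X)"
proof -
  have "basis_of M {e} B \<longleftrightarrow> B = {e}" for B
    using assms by (auto simp: basis_of_def subset_singleton_iff)
  then show ?thesis
    by (auto simp: indep_contract)
qed

lemma spans_delete_iff:
  assumes "I \<subseteq> ground M - D" "x \<in> ground M - D"
  shows "spans (delete M D) I x \<longleftrightarrow> spans M I x"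
  using assms by (auto simp: spans_def)

lemma proper_minor_delete:
  assumes "p \<in> ground M"
  shows "proper_minor (delete M {p}) M"
proof -
  have "minor (delete M {p}) M"
    unfolding minor_def using assms by (intro exI[of _ "{}"] exI[of _ "{p}"]) (simp add: contract_empty)
  moreover have "delete M {p} \<noteq> M"
    using ground_delete[of M "{p}"] assms by force
  ultimately show ?thesis
    by (simp add: proper_minor_def)
qed

lemma proper_minor_contract:
  assumes "e \<in> ground M"
  shows "proper_minor (contract M {e}) M"
proof -
  have "delete (contract M {e}) {} = contract M {e}"
    using indep_subset_ground[of "contract M {e}"] by (intro matroid_eqI) (auto simp: fun_eq_iff)
  then have "minor (contract M {e}) M"
    unfolding minor_def using assms by (intro exI[of _ "{e}"] exI[of _ "{}"]) simp
  moreover have "contract M {e} \<noteq> M"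
    using ground_contract[of M "{e}"] assms by force
  ultimately show ?thesis
    by (simp add: proper_minor_def)
qed

section \<open>Projective planes in matroids\<close>

text \<open>
  The properties of a \<open>PG(2,q)\<close>-restriction that the argument uses. The field has
  been reduced to its order \<open>q\<close>: the count of points makes representations of the plane fill their
  span, and the remaining clauses say that lines have at least three points and that the plane
  is simple of rank three.
\<close>
locale projective_plane =
  fixes M :: "'a matroid" and P :: "'a set" and q :: nat
  assumes order: "1 < q"
    and subset: "P \<subseteq> ground M"
    and card: "(q - 1) * card P + 1 = q ^ 3"
    and rank_le: "Z \<subseteq> P \<Longrightarrow> indep M Z \<Longrightarrow> card Z \<le> 3"
    and pair: "x \<in> P \<Longrightarrow> y \<in> P \<Longrightarrow> indep M {x, y}"
    and third_point: "x \<in> P \<Longrightarrow> y \<in> P \<Longrightarrow> x \<noteq> y \<Longrightarrow> \<exists>z\<in>P - {x, y}. \<not> indep M {x, y, z}"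
    and off_line: "x \<in> P \<Longrightarrow> y \<in> P \<Longrightarrow> x \<noteq> y \<Longrightarrow> \<exists>z\<in>P - {x, y}. indep M {x, y, z}"
begin

lemma basis_spans:
  assumes "J \<subseteq> P" "indep M J" "card J = 3" "x \<in> P"
  shows "spans M J x"
proof (rule ccontr)
  assume "\<not> spans M J x"
  then have "x \<notin> J" "indep M (insert x J)"
    by (auto simp: spans_def)
  then show False
    using rank_le[of "insert x J"] assms indep_finite[OF assms(2)] by simp
qed

text \<open>
  Two distinct lines \<open>ab\<close> and \<open>cd\<close> through \<open>p\<close>, presented by points other than \<open>p\<close>. They
  still determine \<open>p\<close> after \<open>p\<close> has been deleted.
\<close>
definition two_lines :: "'a \<Rightarrow> 'a \<Rightarrow> 'a \<Rightarrow> 'a \<Rightarrow> 'a \<Rightarrow> bool" where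
  "two_lines p a b c d \<longleftrightarrow>
     {a, b, c, d} \<subseteq> P - {p} \<and> a \<noteq> b \<and> c \<noteq> d \<and> a \<noteq> c \<and>
     spans M {a, b} p \<and> spans M {c, d} p \<and> indep M {p, a, c}"

lemma two_lines_exist:
  assumes "p \<in> P" "a \<in> P - {p}"
  shows "\<exists>b c d. two_lines p a b c d"
proof -
  obtain b where b: "b \<in> P - {p, a}" "\<not> indep M {p, a, b}"
    using third_point[of p a] assms by auto
  obtain c where c: "c \<in> P - {p, a}" "indep M {p, a, c}"
    using off_line[of p a] assms by auto
  obtain d where d: "d \<in> P - {p, c}" "\<not> indep M {p, c, d}"
    using third_point[of p c] assms c by auto
  have "two_lines p a b c d"
    unfolding two_lines_def using assms b c d by (auto simp: spans_def)
  then show ?thesis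
    by blast
qed

text \<open>
  If \<open>x\<close> were not parallel to \<open>p\<close>, both lines would be the line \<open>px\<close>, and \<open>p, a, c\<close> would be
  collinear.
\<close>
lemma two_lines_meet:
  assumes L: "two_lines p a b c d" and p: "p \<in> P"
    and x: "spans M {a, b} x" "spans M {c, d} x"
  shows "spans M {x} p"
proof (rule ccontr)
  assume "\<not> spans M {x} p"
  then have xp: "indep M {p, x}" "p \<noteq> x"
    by (auto simp: spans_def)
  have P: "a \<in> P" "b \<in> P" "c \<in> P" "d \<in> P" "a \<noteq> b" "c \<noteq> d" "a \<noteq> c" "a \<noteq> p" "c \<noteq> p"
    and pac: "indep M {p, a, c}"
    using L by (auto simp: two_lines_def)
  have "spans M {p, x} a"
    by (rule spans_eqI[of M "{a, b}"]) (use P pair xp x L in \<open>auto simp: two_lines_def spans_base\<close>)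
  moreover have "spans M {p, x} c"
    by (rule spans_eqI[of M "{c, d}"]) (use P pair xp x L in \<open>auto simp: two_lines_def spans_base\<close>)
  ultimately have "card {p, a, c} \<le> card {p, x}"
    by (intro card_indep_le_spanning[OF xp(1) pac]) (auto simp: spans_base)
  then show False
    using P xp by simp
qed

text \<open>
  Given two lines \<open>ab\<close> and \<open>cd\<close> through \<open>p\<close>, the triangle \<open>abc\<close> is a basis: \<open>p\<close> is on the line
  \<open>ab\<close>, so \<open>c\<close> on this line would make \<open>p, a, c\<close> collinear.
\<close>
lemma basis_avoiding:
  assumes "p \<in> P"
  shows "\<exists>J \<subseteq> P - {p}. indep M J \<and> card J = 3"
proof -
  have "card P \<noteq> 1"
  proof
    assume "card P = 1"
    then have "q ^ 3 = q ^ 1"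
      using card order by simp
    then show False
      using power_inject_exp[OF order, of 3 1] by simp
  qed
  then have "P \<noteq> {p}"
    by auto
  then obtain a where "a \<in> P - {p}"
    using assms by blast
  then obtain b c d where L: "two_lines p a b c d"
    using two_lines_exist assms by blast
  then have P: "a \<in> P" "b \<in> P" "c \<in> P" "a \<noteq> b" "a \<noteq> c" "a \<noteq> p" "b \<noteq> p" "c \<noteq> p"
    and p: "spans M {a, b} p" and pac: "indep M {p, a, c}"
    by (auto simp: two_lines_def)
  have "\<not> spans M {a, b} c"
  proof
    assume "spans M {a, b} c"
    then have "card {p, a, c} \<le> card {a, b}"
      using P p pac pair by (intro card_indep_le_spanning) (auto simp: spans_base)
    then show False
      using P by simp
  qed
  then have "c \<notin> {a, b}" "indep M {c, a, b}"
    by (auto simp: spans_def)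
  then show ?thesis
    using P by (intro exI[of _ "{c, a, b}"]) auto
qed

text \<open>
  The restriction of \<open>M\<close> to \<open>P\<close> survives contraction of an element \<open>e\<close> off the plane. In a
  representation of \<open>M / e\<close> the sets \<open>I - {e}\<close> and \<open>J\<close> have a common nonzero vector; it lies in the span
  of the plane, hence is parallel to a point of \<open>P\<close>, and that point is spanned by \<open>I - {e}\<close> in
  \<open>M / e\<close>, which is to say by \<open>I\<close> in \<open>M\<close>.
\<close>
lemma contract_meets_plane:
  fixes \<psi> :: "'a \<Rightarrow> nat \<Rightarrow> 'f :: {field, finite}"
  assumes q: "q = CARD('f)"
    and J: "J \<subseteq> P" "indep M J" "card J = 3"
    and I: "indep M I" "I \<inter> J = {}" "\<not> indep M (I \<union> J)"
    and e: "e \<in> I" "\<not> spans M J e"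
    and \<psi>: "represents \<psi> (contract M {e})"
  shows "\<exists>x\<in>P. spans M I x"
proof -
  let ?N = "contract M {e}"
  have eJ: "e \<notin> J" "indep M (insert e J)"
    using e(2) by (auto simp: spans_def)
  have eP: "e \<notin> P"
    using basis_spans[OF J] e(2) by blast
  have "indep M {e}"
    using indep_mono[OF I(1)] e(1) by blast
  note N = indep_contract_nonloop[OF this]
  have ground: "e \<in> ground M" "I \<subseteq> ground M" "J \<subseteq> ground M - {e}"
    using indep_subset_ground[OF I(1)] e(1) J(1) subset eP by auto
  \<comment> \<open>Extending \<open>{x, y}\<close> to a set of size four must use \<open>e\<close>, as the plane has rank three;
    hence distinct points of the plane stay non-parallel after contracting \<open>e\<close>.\<close>
  have pairN: "indep ?N {x, y}" if xy: "x \<in> P" "y \<in> P" for x y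
  proof -
    have "card {x, y} \<le> card (insert e J)"
      using J eJ indep_finite[OF J(2)] by (cases "x = y") auto
    then obtain W where W: "{x, y} \<subseteq> W" "W \<subseteq> {x, y} \<union> insert e J" "indep M W"
        "card W = card (insert e J)"
      using indep_extend[OF pair[OF xy] eJ(2)] by blast
    have "e \<in> W"
    proof (rule ccontr)
      assume "e \<notin> W"
      then have "W \<subseteq> P"
        using W(2) J(1) xy by blast
      then show False
        using rank_le[OF _ W(3)] W(4) J eJ indep_finite[OF J(2)] by simp
    qed
    then have "insert e {x, y} \<subseteq> W"
      using W(1) by simp
    then have "indep M (insert e {x, y})"
      by (rule indep_mono[OF W(3)])
    then show ?thesis
      using xy eP subset by (auto simp: N)
  qed
  have JN: "indep ?N J"
    using ground eJ by (simp add: N)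
  have IN: "indep ?N (I - {e})"
    using ground I(1) e(1) by (auto simp: N insert_absorb)
  have "insert e (I - {e} \<union> J) = I \<union> J"
    using e(1) by blast
  then have "\<not> indep ?N (I - {e} \<union> J)"
    using I(3) by (simp add: N)
  then obtain w where w: "w \<noteq> 0" "w \<in> seq.span (\<psi> ` (I - {e}))" "w \<in> seq.span (\<psi> ` J)"
    using represents_not_skew_iff[OF \<psi> IN JN] by blast
  have sub: "\<psi> x \<in> seq.span (\<psi> ` J)" if x: "x \<in> P" for x
  proof -
    have "spans ?N J x"
      using basis_spans[OF J x] indep_mono[of M "insert e (insert x J)" "insert x J"]
      by (auto simp: spans_def N)
    then show ?thesis
      using represents_spans_iff[OF \<psi> JN] x subset eP by auto
  qed
  have "card (\<psi> ` J) = 3"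
    using card_image[OF represents_indep(1)[OF \<psi> JN]] J(3) by simp
  then have "\<exists>x\<in>P. \<exists>c. c \<noteq> 0 \<and> w = (\<lambda>i. c * \<psi> x i)"
    using represents_indep(2)[OF \<psi> JN] w sub card indep_finite[OF J(2)]
      represents_not_parallel[OF \<psi> pairN] q
    by (intro seq.parallel_classes_cover[where B = "\<psi> ` J"]) auto
  then obtain x c where x: "x \<in> P" "c \<noteq> 0" "w = (\<lambda>i. c * \<psi> x i)"
    by blast
  then have "\<psi> x \<in> seq.span (\<psi> ` (I - {e}))"
    using seq_span_unscale w(2) by blast
  then have "spans ?N (I - {e}) x"
    using represents_spans_iff[OF \<psi> IN] x(1) subset eP by auto
  moreover have "insert e (insert x (I - {e})) = insert x I"
    using e(1) by blast
  ultimately have "spans M I x"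
    using x(1) subset eP ground by (auto simp: spans_def N)
  then show ?thesis
    using x(1) by blast
qed

end

section \<open>Completing a representation of a plane with a missing point\<close>

text \<open>
  \<open>\<phi>\<close> represents \<open>M\<close> with the point \<open>p\<close> deleted, \<open>J\<close> is a basis of the plane, and \<open>v\<close> is a
  vector in the missing direction. The aim is that assigning \<open>v\<close> to \<open>p\<close> represents \<open>M\<close>.
\<close>
locale punctured_plane = projective_plane M P q
  for M :: "'a matroid" and P and q +
  fixes \<phi> :: "'a \<Rightarrow> nat \<Rightarrow> 'f :: {field, finite}" and p :: 'a and J :: "'a set" and v :: "nat \<Rightarrow> 'f"
  assumes q: "q = CARD('f)"
    and p: "p \<in> P"
    and rep: "represents \<phi> (delete M {p})"
    and J: "J \<subseteq> P - {p}" "indep M J" "card J = 3"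
    and v: "v \<in> seq.span (\<phi> ` J)" "v \<noteq> 0"
    and missed: "\<And>x c. x \<in> P - {p} \<Longrightarrow> c \<noteq> 0 \<Longrightarrow> v \<noteq> (\<lambda>i. c * \<phi> x i)"
begin

lemma J_subset: "J \<subseteq> P"
  using J(1) by blast

lemma indep_delete_p: "indep M I \<Longrightarrow> p \<notin> I \<Longrightarrow> indep (delete M {p}) I"
  using indep_subset_ground by fastforce

lemma spans_iff:
  assumes "indep M I" "p \<notin> I" "x \<in> ground M - {p}"
  shows "spans M I x \<longleftrightarrow> \<phi> x \<in> seq.span (\<phi> ` I)"
proof -
  have "spans (delete M {p}) I x \<longleftrightarrow> spans M I x"
    using assms indep_subset_ground[OF assms(1)] by (intro spans_delete_iff) auto
  then show ?thesis
    using represents_spans_iff[OF rep indep_delete_p[OF assms(1,2)]] assms(3) by simp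
qed

lemma in_span_J: "x \<in> P - {p} \<Longrightarrow> \<phi> x \<in> seq.span (\<phi> ` J)"
  using spans_iff[OF J(2), of x] J basis_spans[OF J_subset J(2,3), of x] subset by blast

lemma not_parallel:
  assumes "x \<in> P - {p}" "y \<in> P - {p}"
  shows "\<phi> x \<noteq> 0" and "x \<noteq> y \<Longrightarrow> \<phi> x \<noteq> (\<lambda>i. c * \<phi> y i)"
  using represents_not_parallel[OF rep indep_delete_p[OF pair[of x y]]] assms by auto

text \<open>
  Assigning \<open>v\<close> to \<open>p\<close> makes the family of all points pairwise non-parallel, so it covers every
  direction in the span.
\<close>
lemma directions:
  assumes w: "w \<in> seq.span (\<phi> ` J)" "w \<noteq> 0"
  obtains (point) x c where "x \<in> P - {p}" "c \<noteq> 0" "w = (\<lambda>i. c * \<phi> x i)"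
  | (missing) c where "c \<noteq> 0" "w = (\<lambda>i. c * v i)"
proof -
  let ?\<psi> = "\<phi>(p := v)"
  have rJ: "inj_on \<phi> J" "seq.independent (\<phi> ` J)"
    using represents_indep[OF rep indep_delete_p[OF J(2)]] J(1) by auto
  have np: "?\<psi> x \<noteq> (\<lambda>i. c * ?\<psi> y i)" if xy: "x \<in> P" "y \<in> P" "x \<noteq> y" for x y c
  proof (cases "x = p")
    case True
    then show ?thesis
      using missed[of y c] v(2) xy by (cases "c = 0") (auto simp: zero_fun_def)
  next
    case x: False
    show ?thesis
    proof (cases "y = p")
      case True
      show ?thesis
      proof
        assume "?\<psi> x = (\<lambda>i. c * ?\<psi> y i)"
        then have xv: "\<phi> x = (\<lambda>i. c * v i)"
          using True x by simp
        then have c: "c \<noteq> 0"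
          using not_parallel(1)[of x x] x xy by (auto simp: zero_fun_def)
        then have "v = (\<lambda>i. inverse c * \<phi> x i)"
          using xv by (simp add: fun_eq_iff)
        then show False
          using missed[of x "inverse c"] c x xy by simp
      qed
    next
      case False
      then show ?thesis
        using not_parallel(2)[of x y c] x xy by auto
    qed
  qed
  have "\<exists>x\<in>P. \<exists>c. c \<noteq> 0 \<and> w = (\<lambda>i. c * ?\<psi> x i)"
  proof (rule seq.parallel_classes_cover[where B = "\<phi> ` J"])
    show "(CARD('f) - 1) * card P + 1 = CARD('f) ^ card (\<phi> ` J)"
      using card card_image[OF rJ(1)] J(3) q by simp
    show "?\<psi> ` P \<subseteq> seq.span (\<phi> ` J)"
      using in_span_J v(1) by auto
    show "?\<psi> x \<noteq> 0" if "x \<in> P" for x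
      using v(2) not_parallel(1)[of x x] that by auto
  qed (use w rJ(2) indep_finite[OF J(2)] np in auto)
  then obtain x c where "x \<in> P" "c \<noteq> 0" "w = (\<lambda>i. c * ?\<psi> x i)"
    by blast
  then show thesis
    using point[of x c] missing[of c] by (cases "x = p") auto
qed

text \<open>
  Lines \<open>ab\<close> and \<open>cd\<close> give two-dimensional subspaces of a three-dimensional space, so these have
  a common nonzero vector \<open>w\<close>. If \<open>w\<close> were parallel to \<open>\<phi> x\<close> for a point \<open>x \<noteq> p\<close>, the two lines would meet
  in \<open>x\<close>, but in \<open>M\<close> they meet in \<open>p\<close>. So \<open>w\<close> has the missing direction: \<open>v\<close> lies on
  the lines through \<open>p\<close>.
\<close>
lemma v_on_two_lines:
  assumes "two_lines p a b c d"
  shows "v \<in> seq.span (\<phi> ` {a, b})" "v \<in> seq.span (\<phi> ` {c, d})"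
proof -
  have P: "a \<in> P - {p}" "b \<in> P - {p}" "c \<in> P - {p}" "d \<in> P - {p}" "a \<noteq> b" "c \<noteq> d"
    using assms by (auto simp: two_lines_def)
  have ab: "indep M {a, b}" and cd: "indep M {c, d}"
    using pair P by auto
  have "{a, b} \<inter> {c, d} \<noteq> {} \<or> \<not> indep M ({a, b} \<union> {c, d})"
  proof (rule ccontr)
    assume "\<not> ({a, b} \<inter> {c, d} \<noteq> {} \<or> \<not> indep M ({a, b} \<union> {c, d}))"
    then have "indep M {a, b, c, d}" "a \<notin> {c, d}" "b \<notin> {c, d}"
      by (auto simp: insert_commute)
    then show False
      using rank_le[of "{a, b, c, d}"] P by simp
  qed
  then have "{a, b} \<inter> {c, d} \<noteq> {} \<or> \<not> indep (delete M {p}) ({a, b} \<union> {c, d})"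
    by auto
  moreover have "indep (delete M {p}) {a, b}" and "indep (delete M {p}) {c, d}"
    using indep_delete_p[OF ab] indep_delete_p[OF cd] P by auto
  note represents_not_skew_iff[OF rep this]
  ultimately obtain w where w: "w \<noteq> 0" "w \<in> seq.span (\<phi> ` {a, b})" "w \<in> seq.span (\<phi> ` {c, d})"
    using represents_not_skew_iff[OF rep] by blast
  have "seq.span (\<phi> ` {a, b}) \<subseteq> seq.span (\<phi> ` J)"
    using in_span_J P by (intro seq.span_minimal) auto
  then have "w \<in> seq.span (\<phi> ` J)"
    using w(2) by blast
  from this w(1) have "\<exists>k. k \<noteq> 0 \<and> w = (\<lambda>i. k * v i)"
  proof (cases rule: directions)
    case (point x k)
    then have "\<phi> x \<in> seq.span (\<phi> ` {a, b})" "\<phi> x \<in> seq.span (\<phi> ` {c, d})"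
      using seq_span_unscale[OF point(3,2)] w(2,3) by blast+
    then have "spans M {a, b} x" "spans M {c, d} x"
      using spans_iff[OF ab, of x] spans_iff[OF cd, of x] P point(1) subset by auto
    then have "spans M {x} p"
      using two_lines_meet[OF assms p] by blast
    then show ?thesis
      using pair[of p x] p point(1) by (auto simp: spans_def)
  qed auto
  then show "v \<in> seq.span (\<phi> ` {a, b})" "v \<in> seq.span (\<phi> ` {c, d})"
    using seq_span_unscale[of w _ v] w(2,3) by blast+
qed

lemma line_through_missing:
  assumes "a \<in> P - {p}"
  obtains b where "b \<in> P - {p}" "a \<noteq> b" "spans M {a, b} p" "v \<in> seq.span (\<phi> ` {a, b})"
proof -
  obtain b c d where L: "two_lines p a b c d"
    using two_lines_exist[OF p assms] by blast
  show thesis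
    using that[of b] v_on_two_lines(1)[OF L] L by (auto simp: two_lines_def)
qed

text \<open>
  An element in the closure of the plane is represented in the three-dimensional span, so its
  direction is that of a point \<open>x \<noteq> p\<close>, to which it is then parallel, or the missing one. In the
  latter case it lies on two lines through \<open>p\<close> and is parallel to \<open>p\<close>.
\<close>
lemma parallel_to_plane:
  assumes e: "indep M {e}" "spans M J e"
  shows "\<exists>x\<in>P. spans M {e} x"
proof (cases "e \<in> P")
  case True
  then show ?thesis
    by (auto simp: spans_def)
next
  case False
  then have eg: "e \<in> ground M - {p}" and "p \<notin> J" "p \<notin> {e}"
    using indep_subset_ground[OF e(1)] p J(1) by auto
  have "\<phi> e \<in> seq.span (\<phi> ` J)"
    using spans_iff[OF J(2) \<open>p \<notin> J\<close> eg] e(2) by simp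
  moreover have "\<phi> e \<noteq> 0"
    using represents_not_parallel(1)[OF rep, of e e] indep_delete_p[OF e(1) \<open>p \<notin> {e}\<close>] by simp
  ultimately show ?thesis
  proof (cases rule: directions)
    case (point x c)
    have "\<phi> e \<in> seq.span (\<phi> ` {x})"
      unfolding point(3) by (intro seq.span_scale seq.span_base) simp
    then have "spans M {x} e"
      by (rule iffD2[OF spans_iff, rotated 3]) (use pair[of x x] point(1) eg in auto)
    moreover have "x \<noteq> e"
      using False point(1) by auto
    ultimately have "spans M {e} x"
      by (auto simp: spans_def insert_commute)
    then show ?thesis
      using point(1) by blast
  next
    case (missing k)
    obtain a where "a \<in> P - {p}"
      using J by (metis card.empty ex_in_conv numeral_eq_iff subsetD zero_neq_numeral)
    then obtain b c d where L: "two_lines p a b c d"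
      using two_lines_exist[OF p] by blast
    then have P: "a \<in> P - {p}" "b \<in> P - {p}" "c \<in> P - {p}" "d \<in> P - {p}"
      by (auto simp: two_lines_def)
    have "spans M {a, b} e"
      by (rule iffD2[OF spans_iff, rotated 3], unfold missing(2),
        intro seq.span_scale v_on_two_lines(1)[OF L]) (use pair[of a b] P eg in auto)
    moreover have "spans M {c, d} e"
      by (rule iffD2[OF spans_iff, rotated 3], unfold missing(2),
        intro seq.span_scale v_on_two_lines(2)[OF L]) (use pair[of c d] P eg in auto)
    ultimately have "spans M {e} p"
      by (rule two_lines_meet[OF L p])
    then show ?thesis
      using p by blast
  qed
qed

text \<open>
  A form of modularity of \<open>P\<close>: an independent set that is not skew to the plane spans one of its
  points. If all of \<open>I\<close> lies in the closure of the plane, any element of \<open>I\<close> is parallel to a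
  point; otherwise an element off the plane can be contracted.
\<close>
lemma meets_plane:
  assumes con: "\<And>e. e \<in> ground M \<Longrightarrow> \<exists>\<psi> :: 'a \<Rightarrow> nat \<Rightarrow> 'f. represents \<psi> (contract M {e})"
    and I: "indep M I" and IJ: "I \<inter> J = {}" "\<not> indep M (I \<union> J)"
  shows "\<exists>x\<in>P. spans M I x"
proof (cases "\<forall>e\<in>I. spans M J e")
  case True
  have "I \<noteq> {}"
    using IJ(2) J(2) by auto
  then obtain e where e: "e \<in> I"
    by blast
  then have "indep M {e}"
    using indep_mono[OF I] by simp
  then obtain x where "x \<in> P" "spans M {e} x"
    using parallel_to_plane True e by blast
  then show ?thesis
    using spans_mono[of M "{e}" x I] e by auto
next
  case False
  then obtain e where e: "e \<in> I" "\<not> spans M J e"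
    by blast
  then have "e \<in> ground M"
    using indep_subset_ground[OF I] by blast
  then obtain \<psi> :: "'a \<Rightarrow> nat \<Rightarrow> 'f" where "represents \<psi> (contract M {e})"
    using con by blast
  then show ?thesis
    by (intro contract_meets_plane[OF q J_subset J(2,3) I IJ e])
qed

text \<open>
  If \<open>I\<close> spans some point \<open>a \<noteq> p\<close>, take a further point \<open>b\<close> on the line \<open>ap\<close>. On both sides the
  third collinear point follows from the other two: \<open>I\<close> spans \<open>p\<close> iff it spans \<open>b\<close>, iff the span
  of \<open>\<phi> ` I\<close> contains \<open>v\<close>. If \<open>I\<close> spans no such point, both sides are equivalent to \<open>I\<close> not
  being skew to the plane: in \<open>M\<close> because the point obtained from modularity can only be
  \<open>p\<close>, and in the vector space because the common vector can only have the direction of \<open>v\<close>.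
\<close>
lemma spans_missing_iff:
  assumes con: "\<And>e. e \<in> ground M \<Longrightarrow> \<exists>\<psi> :: 'a \<Rightarrow> nat \<Rightarrow> 'f. represents \<psi> (contract M {e})"
    and I: "indep M I" "p \<notin> I"
  shows "spans M I p \<longleftrightarrow> v \<in> seq.span (\<phi> ` I)"
proof (cases "\<exists>a\<in>P - {p}. spans M I a")
  case True
  then obtain a where a: "a \<in> P - {p}" "spans M I a"
    by blast
  obtain b where b: "b \<in> P - {p}" "a \<noteq> b" "spans M {a, b} p" "v \<in> seq.span (\<phi> ` {a, b})"
    using line_through_missing[OF a(1)] by blast
  have aI: "\<phi> a \<in> seq.span (\<phi> ` I)"
    using spans_iff[OF I, of a] a subset by auto
  have ab: "indep M {a, b}" and ap: "indep M {a, p}"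
    using pair[of a b] pair[of a p] a b p by auto
  show ?thesis
  proof
    assume "spans M I p"
    moreover have "spans M {a, p} b"
      using a(1) b(1,3) p by (auto simp: spans_def insert_commute)
    ultimately have "spans M I b"
      using spans_trans[OF I(1) ap] a(2) by blast
    then have "\<phi> b \<in> seq.span (\<phi> ` I)"
      using spans_iff[OF I, of b] b(1) subset by auto
    then have "seq.span (\<phi> ` {a, b}) \<subseteq> seq.span (\<phi> ` I)"
      using aI by (intro seq.span_minimal) auto
    then show "v \<in> seq.span (\<phi> ` I)"
      using b(4) by blast
  next
    assume vI: "v \<in> seq.span (\<phi> ` I)"
    have "\<phi> b \<in> seq.span {v, \<phi> a}"
    proof -
      have "v \<in> seq.span (insert (\<phi> b) {\<phi> a})"
        using b(4) by (simp add: insert_commute)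
      moreover have "v \<notin> seq.span {\<phi> a}"
      proof
        assume "v \<in> seq.span {\<phi> a}"
        then obtain k where k: "v = (\<lambda>i. k * \<phi> a i)"
          by (auto simp: seq.span_singleton)
        then show False
          using missed[OF a(1), of k] v(2) by (cases "k = 0") (auto simp: zero_fun_def)
      qed
      ultimately show ?thesis
        by (rule seq.in_span_insert)
    qed
    moreover have "seq.span {v, \<phi> a} \<subseteq> seq.span (\<phi> ` I)"
      using aI vI by (intro seq.span_minimal) auto
    ultimately have "spans M I b"
      using spans_iff[OF I, of b] b(1) subset by auto
    then show "spans M I p"
      using spans_trans[OF I(1) ab _ b(3)] a(2) by blast
  qed
next
  case False
  have "I \<inter> J = {}"
    using False J(1) spans_base by fastforce
  have skew: "\<not> indep M (I \<union> J) \<longleftrightarrow>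
      (\<exists>w. w \<noteq> 0 \<and> w \<in> seq.span (\<phi> ` I) \<and> w \<in> seq.span (\<phi> ` J))"
  proof -
    have pJ: "p \<notin> J"
      using J(1) by auto
    have "I \<union> J \<subseteq> ground M - {p}"
      using I(2) pJ indep_subset_ground[OF I(1)] indep_subset_ground[OF J(2)] by auto
    then have "indep (delete M {p}) (I \<union> J) \<longleftrightarrow> indep M (I \<union> J)"
      by simp
    then show ?thesis
      using represents_not_skew_iff[OF rep indep_delete_p[OF I] indep_delete_p[OF J(2) pJ]]
        \<open>I \<inter> J = {}\<close> by simp
  qed
  show ?thesis
  proof
    assume "spans M I p"
    then have "\<not> indep M (I \<union> J)"
      using common_span_not_skew[OF I(1) J(2) \<open>I \<inter> J = {}\<close>] pair[OF p p]
        basis_spans[OF J_subset J(2,3) p] by simp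
    then obtain w where w: "w \<noteq> 0" "w \<in> seq.span (\<phi> ` I)" "w \<in> seq.span (\<phi> ` J)"
      using skew by blast
    from w(3,1) show "v \<in> seq.span (\<phi> ` I)"
    proof (cases rule: directions)
      case (point x c)
      then have "\<phi> x \<in> seq.span (\<phi> ` I)"
        using seq_span_unscale[OF point(3,2) w(2)] by blast
      then have "spans M I x"
        using spans_iff[OF I, of x] point(1) subset by auto
      then show ?thesis
        using False point(1) by blast
    next
      case (missing c)
      then show ?thesis
        using seq_span_unscale[OF missing(2,1) w(2)] by blast
    qed
  next
    assume "v \<in> seq.span (\<phi> ` I)"
    then have "\<not> indep M (I \<union> J)"
      using skew v by blast
    then show "spans M I p"
      using meets_plane[OF con I(1) \<open>I \<inter> J = {}\<close>] False by blast
  qed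
qed

text \<open>
  Sets avoiding \<open>p\<close> are handled by \<open>\<phi>\<close>; a set containing \<open>p\<close> is independent iff the rest is
  independent and does not span \<open>p\<close>.
\<close>
lemma represents_completion:
  assumes con: "\<And>e. e \<in> ground M \<Longrightarrow> \<exists>\<psi> :: 'a \<Rightarrow> nat \<Rightarrow> 'f. represents \<psi> (contract M {e})"
  shows "represents (\<phi>(p := v)) M"
  unfolding represents_def
proof (intro allI impI)
  fix X assume X: "X \<subseteq> ground M"
  let ?\<psi> = "\<phi>(p := v)"
  let ?I = "X - {p}"
  have eq: "inj_on ?\<psi> ?I \<longleftrightarrow> inj_on \<phi> ?I" "?\<psi> ` ?I = \<phi> ` ?I"
    by (auto simp: inj_on_def)
  have del: "indep M ?I \<longleftrightarrow> inj_on \<phi> ?I \<and> seq.independent (\<phi> ` ?I)"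
    using represents_iff[OF rep, of ?I] X by auto
  show "indep M X \<longleftrightarrow> inj_on ?\<psi> X \<and> seq.independent (?\<psi> ` X)"
  proof (cases "p \<in> X")
    case False
    then show ?thesis
      using del eq by simp
  next
    case True
    then have X_eq: "X = insert p ?I"
      by auto
    show ?thesis
    proof (cases "indep M ?I")
      case I: True
      have "indep M X \<longleftrightarrow> v \<notin> seq.span (\<phi> ` ?I)"
        using spans_missing_iff[OF con I] X_eq by (auto simp: spans_def)
      moreover have "inj_on ?\<psi> X \<and> seq.independent (?\<psi> ` X) \<longleftrightarrow>
          v \<notin> \<phi> ` ?I \<and> seq.independent (insert v (\<phi> ` ?I))"
      proof -
        have "inj_on ?\<psi> X \<longleftrightarrow> v \<notin> \<phi> ` ?I"
        proof -
          have "inj_on ?\<psi> (insert p ?I) \<longleftrightarrow> inj_on ?\<psi> ?I \<and> v \<notin> ?\<psi> ` ?I"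
            unfolding inj_on_insert by simp
          then show ?thesis
            unfolding X_eq[symmetric] using I del eq by metis
        qed
        moreover have "?\<psi> ` X = insert v (\<phi> ` ?I)"
        proof -
          have "?\<psi> ` insert p ?I = insert v (?\<psi> ` ?I)"
            unfolding image_insert by simp
          then show ?thesis
            unfolding X_eq[symmetric] eq(2) .
        qed
        ultimately show ?thesis
          by simp
      qed
      moreover have "v \<notin> \<phi> ` ?I \<and> seq.independent (insert v (\<phi> ` ?I)) \<longleftrightarrow> v \<notin> seq.span (\<phi> ` ?I)"
        using I del seq.span_base[of v "\<phi> ` ?I"] by (auto simp: seq.independent_insert)
      ultimately show ?thesis
        by blast
    next
      case False
      then have "\<not> indep M X"
        using indep_mono[of M X ?I] by auto
      moreover have "\<not> (inj_on ?\<psi> X \<and> seq.independent (?\<psi> ` X))"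
        using False del eq inj_on_subset[of ?\<psi> X ?I] seq.independent_mono[of "?\<psi> ` X" "?\<psi> ` ?I"]
        by auto
      ultimately show ?thesis
        by blast
    qed
  qed
qed

end

section \<open>The plane over a finite field\<close>

lemma ground_PG: "ground PG = proj_points"
  by (simp only: ground.rep_eq PG.rep_eq fst_conv)

lemma indep_PG: "indep PG X \<longleftrightarrow> X \<subseteq> proj_points \<and> vec.dim (\<Union>X) = card X"
  by (simp only: indep.rep_eq PG.rep_eq snd_conv)

lemma span_singleton_subset_iff:
  fixes s :: "'f :: field ^ 'n"
  shows "vec.span {s} \<subseteq> vec.span A \<longleftrightarrow> s \<in> vec.span A"
  using vec.span_base[of s "{s}"] vec.span_minimal[of "{s}" "vec.span A"] by auto

lemma proj_points_subset_eq:
  assumes x: "x \<in> proj_points" and y: "y \<in> proj_points" and "x \<subseteq> y"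
  shows "x = (y :: ('f :: field ^ 'n) set)"
proof -
  obtain s t where s: "x = vec.span {s}" "s \<noteq> 0" and t: "y = vec.span {t}"
    using x y unfolding proj_points_def by blast
  then have "s \<in> vec.span {t}"
    using assms(3) span_singleton_subset_iff by blast
  then obtain c where c: "s = c *s t"
    by (auto simp: vec.span_singleton)
  then have "c \<noteq> 0"
    using s(2) by auto
  then have "t = inverse c *s s"
    using c by simp
  then have "t \<in> vec.span {s}"
    using vec.span_scale[OF vec.span_base[of s "{s}"]] by simp
  then show ?thesis
    using assms(3) s t span_singleton_subset_iff[of t "{s}"] by blast
qed

lemma dim_two_points:
  fixes x y :: "('f :: field ^ 'n) set"
  assumes "x \<in> proj_points" "y \<in> proj_points" "x \<noteq> y"
  shows "vec.dim (\<Union>{x, y}) = 2"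
proof -
  obtain t where t: "y = vec.span {t}" "t \<noteq> 0"
    using assms(2) unfolding proj_points_def by blast
  then have "vec.dim y = 1"
    by (simp add: vec.dim_eq_card_independent)
  moreover have "\<not> x \<subseteq> vec.span (\<Union>{y})"
    using proj_points_subset_eq[OF assms(1,2)] assms(3) t by (auto simp: vec.span_span)
  ultimately show ?thesis
    using dim_Union_insert[OF assms(1), of "{y}"] by simp
qed

text \<open>
  Choosing a generator for each point gives a family of vectors whose nonzero multiples are all
  nonzero vectors, each obtained once.
\<close>
lemma card_proj_points:
  "(CARD('f) - 1) * card (proj_points :: ('f :: {field, finite} ^ 'n) set set) + 1 =
     CARD('f) ^ CARD('n)"
proof -
  let ?P = "proj_points :: ('f ^ 'n) set set"
  define r :: "('f ^ 'n) set \<Rightarrow> 'f ^ 'n" where "r x = (SOME s. s \<noteq> 0 \<and> x = vec.span {s})" for x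
  have r: "r x \<noteq> 0" "x = vec.span {r x}" if "x \<in> ?P" for x
  proof -
    have "\<exists>s. s \<noteq> 0 \<and> x = vec.span {s}"
      using that unfolding proj_points_def by blast
    then have "r x \<noteq> 0 \<and> x = vec.span {r x}"
      unfolding r_def by (rule someI_ex)
    then show "r x \<noteq> 0" "x = vec.span {r x}"
      by auto
  qed
  have "card {c *s r x | c x. c \<noteq> 0 \<and> x \<in> ?P} = (CARD('f) - 1) * card ?P"
  proof (rule vec.card_multiples)
    fix x y c
    assume xy: "x \<in> ?P" "y \<in> ?P" "x \<noteq> y"
    show "r x \<noteq> c *s r y"
    proof
      assume "r x = c *s r y"
      then have "r x \<in> vec.span {r y}"
        using vec.span_scale[OF vec.span_base[of "r y" "{r y}"]] by simp
      then have "x \<subseteq> y"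
        using r(2)[OF xy(1)] r(2)[OF xy(2)] span_singleton_subset_iff by metis
      then show False
        using proj_points_subset_eq xy by blast
    qed
  qed (use r in auto)
  moreover have "{c *s r x | c x. c \<noteq> 0 \<and> x \<in> ?P} = UNIV - {0}"
  proof (intro equalityI subsetI)
    fix w :: "'f ^ 'n"
    assume "w \<in> UNIV - {0}"
    then have w: "w \<noteq> 0" and x: "vec.span {w} \<in> ?P"
      by (auto simp: proj_points_def)
    have "w \<in> vec.span {r (vec.span {w})}"
      using r(2)[OF x] vec.span_base[of w "{w}"] by blast
    then obtain c where "w = c *s r (vec.span {w})"
      by (auto simp: vec.span_singleton)
    moreover have "c \<noteq> 0"
      using calculation w by (metis vec.scale_zero_left)
    ultimately show "w \<in> {c *s r x | c x. c \<noteq> 0 \<and> x \<in> ?P}"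
      using x by blast
  qed (use r in auto)
  moreover have "card (UNIV - {0 :: 'f ^ 'n}) + 1 = CARD('f) ^ CARD('n)"
    by (simp add: card_Diff_subset)
  ultimately show ?thesis
    by simp
qed

lemma projective_plane_PG:
  "projective_plane (PG :: ('f :: {field, finite} ^ 3) set matroid) proj_points (CARD('f))"
proof
  let ?P = "proj_points :: ('f ^ 3) set set"
  have "card {0, 1 :: 'f} \<le> CARD('f)"
    by (rule card_mono) auto
  then show "1 < CARD('f)"
    by simp
  show "?P \<subseteq> ground PG"
    by (simp add: ground_PG)
  show "(CARD('f) - 1) * card ?P + 1 = CARD('f) ^ 3"
    using card_proj_points[where 'f = 'f and 'n = 3] by simp
  show "card Z \<le> 3" if "indep PG Z" for Z :: "('f ^ 3) set set"
    using that dim_subset_UNIV_cart_gen[of "\<Union>Z"] by (simp add: indep_PG)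
  fix x y assume x: "x \<in> ?P" and y: "y \<in> ?P"
  show "indep PG {x, y}"
  proof (cases "x = y")
    case True
    then show ?thesis
      using x by (auto simp: indep_PG proj_points_def vec.dim_eq_card_independent)
  next
    case False
    then show ?thesis
      using dim_two_points[OF x y] x y by (simp add: indep_PG)
  qed
  assume ne: "x \<noteq> y"
  have dim: "vec.dim (\<Union>{x, y}) = 2"
    using dim_two_points[OF x y ne] .
  obtain s t where s: "x = vec.span {s}" "s \<noteq> 0" and t: "y = vec.span {t}" "t \<noteq> 0"
    using x y unfolding proj_points_def by blast
  have st: "s \<notin> vec.span {t}" "t \<notin> vec.span {s}"
    using proj_points_subset_eq[OF x y] proj_points_subset_eq[OF y x] ne s t
    by (auto simp: span_singleton_subset_iff)
  \<comment> \<open>The third point on the line through the points of \<open>s\<close> and \<open>t\<close> is generated by \<open>s + t\<close>,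
    which is possible over every field.\<close>
  show "\<exists>z\<in>?P - {x, y}. \<not> indep PG {x, y, z}"
  proof
    let ?z = "vec.span {s + t}"
    have "?z \<noteq> x"
    proof
      assume "?z = x"
      then have "s + t - s \<in> vec.span {s}"
        using s vec.span_base by (metis singletonI vec.span_diff)
      then show False
        using st by simp
    qed
    moreover have "?z \<noteq> y"
    proof
      assume "?z = y"
      then have "s + t - t \<in> vec.span {t}"
        using t vec.span_base by (metis singletonI vec.span_diff)
      then show False
        using st by simp
    qed
    moreover have "s + t \<noteq> 0"
    proof
      assume "s + t = 0"
      then have "s = - t"
        by (simp add: eq_neg_iff_add_eq_0)
      then show False
        using st(1) vec.span_neg[OF vec.span_base[of t "{t}"]] by simp
    qed
    then have z: "?z \<in> ?P"
      unfolding proj_points_def by blast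
    ultimately show "?z \<in> ?P - {x, y}"
      by simp
    have "s \<in> \<Union>{x, y}" "t \<in> \<Union>{x, y}"
      using s t vec.span_base by auto
    then have "s + t \<in> vec.span (\<Union>{x, y})"
      by (intro vec.span_add vec.span_base)
    then have "?z \<subseteq> vec.span (\<Union>{x, y})"
      by (simp add: span_singleton_subset_iff)
    then have "vec.dim (\<Union>{?z, x, y}) = 2"
      using dim_Union_insert[OF z, of "{x, y}"] dim by simp
    moreover have "card {?z, x, y} = 3"
      using \<open>?z \<noteq> x\<close> \<open>?z \<noteq> y\<close> ne by simp
    ultimately have "\<not> indep PG {?z, x, y}"
      by (simp add: indep_PG)
    then show "\<not> indep PG {x, y, ?z}"
      by (simp add: insert_commute)
  qed
  have "vec.span (\<Union>{x, y}) \<noteq> UNIV"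
  proof
    assume "vec.span (\<Union>{x, y}) = UNIV"
    then have "vec.dim (UNIV :: ('f ^ 3) set) = 2"
      using dim by (metis vec.dim_span)
    then show False
      by (simp add: vec_dim_card card_cart_basis)
  qed
  then obtain u where u: "u \<notin> vec.span (\<Union>{x, y})"
    by blast
  show "\<exists>z\<in>?P - {x, y}. indep PG {x, y, z}"
  proof
    let ?z = "vec.span {u}"
    have "u \<noteq> 0"
      using u vec.span_zero by auto
    then have z: "?z \<in> ?P"
      unfolding proj_points_def by blast
    have "\<not> ?z \<subseteq> vec.span (\<Union>{x, y})"
      using u by (simp add: span_singleton_subset_iff)
    then have "vec.dim (\<Union>{?z, x, y}) = 3" and zxy: "?z \<noteq> x" "?z \<noteq> y"
      using dim_Union_insert[OF z, of "{x, y}"] dim vec.span_superset[of "\<Union>{x, y}"] by auto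
    then have "indep PG {?z, x, y}"
      using x y z ne by (simp add: indep_PG)
    then show "indep PG {x, y, ?z}"
      by (simp add: insert_commute)
    show "?z \<in> ?P - {x, y}"
      using z zxy by simp
  qed
qed

lemma projective_plane_isomorphic:
  assumes iso: "isomorphic (restriction M X) N" and X: "X \<subseteq> ground M"
    and N: "projective_plane N (ground N) q"
  shows "projective_plane M X q"
proof -
  interpret N: projective_plane N "ground N" q
    by (rule N)
  have ground: "ground (restriction M X) = X"
    using X by (auto simp: restriction_def)
  obtain f where f: "bij_betw f X (ground N)"
    and ind: "\<And>Y. Y \<subseteq> X \<Longrightarrow> indep (restriction M X) Y \<longleftrightarrow> indep N (f ` Y)"
    using iso unfolding isomorphic_def ground by blast
  have indep: "indep M Y \<longleftrightarrow> indep N (f ` Y)" if "Y \<subseteq> X" for Y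
    using ind[OF that] that X by (auto simp: restriction_def)
  have inj: "inj_on f X" and img: "f ` X = ground N"
    using f by (auto simp: bij_betw_def)
  have third: "\<exists>z\<in>X - {x, y}. R {f x, f y, f z}"
    if "\<exists>w\<in>ground N - {f x, f y}. R {f x, f y, w}" for x y R
    using that unfolding img[symmetric] by auto
  show ?thesis
  proof
    show "1 < q" "X \<subseteq> ground M"
      by (fact N.order, fact X)
    show "(q - 1) * card X + 1 = q ^ 3"
      using N.card bij_betw_same_card[OF f] by simp
    show "card Z \<le> 3" if "Z \<subseteq> X" "indep M Z" for Z
      using N.rank_le[of "f ` Z"] indep[OF that(1)] that img card_image[OF inj_on_subset[OF inj that(1)]]
      by auto
    fix x y assume xy: "x \<in> X" "y \<in> X"
    then have fxy: "f x \<in> ground N" "f y \<in> ground N"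
      using img by auto
    show "indep M {x, y}"
      using N.pair[OF fxy] indep[of "{x, y}"] xy by simp
    assume "x \<noteq> y"
    then have "f x \<noteq> f y"
      using inj xy by (auto dest: inj_onD)
    show "\<exists>z\<in>X - {x, y}. \<not> indep M {x, y, z}"
      using third[of x y "\<lambda>S. \<not> indep N S", OF N.third_point[OF fxy \<open>f x \<noteq> f y\<close>]] indep xy
      by auto
    show "\<exists>z\<in>X - {x, y}. indep M {x, y, z}"
      using third[of x y "indep N", OF N.off_line[OF fxy \<open>f x \<noteq> f y\<close>]] indep xy by auto
  qed
qed

section \<open>Excluded minors\<close>

lemma representable_iff:
  "representable TYPE('f :: field) (M :: 'a matroid) \<longleftrightarrow>
     (\<exists>n. \<exists>\<phi> :: 'a \<Rightarrow> nat \<Rightarrow> 'f. represents \<phi> M \<and> (\<forall>e\<in>ground M. \<forall>i\<ge>n. \<phi> e i = 0))"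
  unfolding representable_def represents_def by blast

text \<open>
  The deletion of one point of the plane supplies the representation to be completed, and the
  single-element contractions supply modularity of the plane.
\<close>
lemma (in projective_plane) representable_if_minors_representable:
  assumes q: "q = CARD('f :: {field, finite})"
    and minors: "\<And>N. proper_minor N M \<Longrightarrow> representable TYPE('f) N"
  shows "representable TYPE('f) M"
proof -
  have "P \<noteq> {}"
    using card order by (auto simp: power3_eq_cube)
  then obtain p where p: "p \<in> P"
    by blast
  obtain J where J: "J \<subseteq> P - {p}" "indep M J" "card J = 3"
    using basis_avoiding[OF p] by blast
  have "representable TYPE('f) (delete M {p})"
    using p subset by (intro minors proper_minor_delete) auto
  then obtain n and \<phi> :: "'a \<Rightarrow> nat \<Rightarrow> 'f" where \<phi>: "represents \<phi> (delete M {p})"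
    and n: "\<forall>e\<in>ground (delete M {p}). \<forall>i\<ge>n. \<phi> e i = 0"
    unfolding representable_iff by blast
  have "indep (delete M {p}) J"
    using J subset by auto
  note rJ = represents_indep[OF \<phi> this]
  have "finite P"
    using finite_subset[OF subset] by simp
  have "card P = Suc (card (P - {p}))"
    using card.remove[OF \<open>finite P\<close> p] .
  then have "(q - 1) * card (P - {p}) + 1 < q ^ 3"
    using card order by simp
  then have few: "(CARD('f) - 1) * card (P - {p}) + 1 < CARD('f) ^ card (\<phi> ` J)"
    using q card_image[OF rJ(1)] J(3) by simp
  have "\<exists>v\<in>seq.span (\<phi> ` J). v \<noteq> 0 \<and> (\<forall>x\<in>P - {p}. \<forall>c. c \<noteq> 0 \<longrightarrow> v \<noteq> (\<lambda>i. c * \<phi> x i))"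
    by (rule seq.parallel_classes_miss[OF _ _ rJ(2) few])
      (use indep_finite[OF J(2)] \<open>finite P\<close> in simp_all)
  then obtain v where v: "v \<in> seq.span (\<phi> ` J)" "v \<noteq> 0"
    and missed: "\<forall>x\<in>P - {p}. \<forall>c. c \<noteq> 0 \<longrightarrow> v \<noteq> (\<lambda>i. c * \<phi> x i)"
    by (elim bexE conjE)
  interpret punctured_plane M P q \<phi> p J v
    by unfold_locales (fact q p \<phi> J v missed[rule_format])+
  have "represents (\<phi>(p := v)) M"
  proof (rule represents_completion)
    fix e assume "e \<in> ground M"
    then show "\<exists>\<psi> :: 'a \<Rightarrow> nat \<Rightarrow> 'f. represents \<psi> (contract M {e})"
      using minors[OF proper_minor_contract] unfolding representable_iff by blast
  qed
  moreover have "(\<phi>(p := v)) e i = 0" if "e \<in> ground M" "n \<le> i" for e i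
  proof -
    \<comment> \<open>Being spanned by vectors of length \<open>n\<close>, the new vector \<open>v\<close> needs no further coordinates.\<close>
    have "seq.span (\<phi> ` J) \<subseteq> {w. w i = 0}"
    proof (rule seq.span_minimal)
      show "\<phi> ` J \<subseteq> {w. w i = 0}"
        using n J subset that by auto
      show "seq.subspace {w :: nat \<Rightarrow> 'f. w i = 0}"
        by (simp add: seq.subspace_def)
    qed
    then show ?thesis
      using v n that by auto
  qed
  ultimately show ?thesis
    unfolding representable_iff by blast
qed

theorem corollary1p7:
  fixes M :: "'a matroid"
  assumes "excluded_minor TYPE('f :: {field, finite}) M"
  shows "\<not> (\<exists>X \<subseteq> ground M. isomorphic (restriction M X) (PG :: ('f ^ 3) set matroid))"
proof
  assume "\<exists>X \<subseteq> ground M. isomorphic (restriction M X) (PG :: ('f ^ 3) set matroid)"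
  then obtain X where X: "X \<subseteq> ground M" "isomorphic (restriction M X) (PG :: ('f ^ 3) set matroid)"
    by blast
  have "projective_plane M X (CARD('f))"
    using projective_plane_isomorphic[OF X(2,1)] projective_plane_PG[where 'f = 'f]
    by (simp add: ground_PG)
  then have "representable TYPE('f) M"
  proof (rule projective_plane.representable_if_minors_representable[OF _ refl])
    fix N assume "proper_minor N M"
    then show "representable TYPE('f) N"
      using assms by (simp add: excluded_minor_def)
  qed
  then show False
    using assms by (simp add: excluded_minor_def)
qed

end
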